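(* Let $k$ be a positive integer and let $n\ge k+1$. Then the symplectic quotients $M_{0,k,n}$ (by $O_n$) and $M_{0,k,n}^{SO}$ (by $SO_n$) coincide. That is, for every $y\in Z_{k,n}$ the $O_n$-orbit of $y$ equals the $SO_n$-orbit of $y$, so that $Z_{k,n}/O_n=Z_{k,n}/SO_n$, and the inclusion $\mathbb{R}[V]^{O_n}\subset\mathbb{R}[V]^{SO_n}$ induces an isomorphism $\mathbb{R}[M_{0,k,n}]\cong\mathbb{R}[M_{0,k,n}^{SO}]$ of algebras of regular functions.
   Context: Let $V=V_{k,n}=(\mathbb{R}^n)^{2k}$ with points $y=(y_1,\dots,y_{2k})$, $y_i=(y_{i,1},\dots,y_{i,n})\in\mathbb{R}^n$. The real orthogonal group $O_n$ and its subgroup $SO_n$ act diagonally on $V$. For $1\le\alpha<\beta\le n$ set $J_{\alpha,\beta}(y)=\sum_{\ell=1}^k (y_{2\ell-1,\alpha}y_{2\ell,\beta}-y_{2\ell-1,\beta}y_{2\ell,\alpha})$ (components of the moment map, the same for $O_n$ and $SO_n$), and let $Z=Z_{k,n}\subset V$ be their common zero set. The symplectic quotients are $M_{0,k,n}=Z/O_n$ and $M_{0,k,n}^{SO}=Z/SO_n$. With $\mathcal{I}_Z\subset\mathbb{R}[V]$ the ideal of polynomials vanishing on $Z$, and $\mathcal{I}_Z^{G}=\mathcal{I}_Z\cap\mathbb{R}[V]^G$, their algebras of regular functions are $\mathbb{R}[M_{0,k,n}]=\mathbb{R}[V]^{O_n}/\mathcal{I}_Z^{O_n}$ and $\mathbb{R}[M_{0,k,n}^{SO}]=\mathbb{R}[V]^{SO_n}/\mathcal{I}_Z^{SO_n}$.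 *)

theory Defs
  imports "HOL-Analysis.Analysis" "HOL-Algebra.Group_Action" "HOL-Algebra.QuotRing"
    "HOL-Algebra.Module"
begin

text \<open>
  The dimensions are carried by finite index types: \<open>n = CARD('n)\<close> and \<open>k = CARD('k)\<close>.  The space
  \<open>(\<real>\<^sup>n)\<^sup>2\<^sup>k\<close> is written as k-tuples of pairs of vectors, with \<open>y $ l $ 1\<close> and \<open>y $ l $ 2\<close>
  standing for the vectors numbered \<open>2 l - 1\<close> and \<open>2 l\<close> respectively.
\<close>

definition O_group :: "(real ^ 'n ^ 'n) monoid" where
  "O_group = \<lparr>carrier = {A. orthogonal_matrix A}, mult = (**), one = mat 1\<rparr>"

definition SO_group :: "(real ^ 'n ^ 'n) monoid" where
  "SO_group = \<lparr>carrier = {A. orthogonal_matrix A \<and> det A = 1}, mult = (**), one = mat 1\<rparr>"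

definition diag_act :: "real ^ 'n ^ 'n \<Rightarrow> real ^ 'n ^ 2 ^ 'k \<Rightarrow> real ^ 'n ^ 2 ^ 'k" where
  "diag_act A y = (\<chi> l i. A *v (y $ l $ i))"

definition moment :: "'n \<Rightarrow> 'n \<Rightarrow> real ^ 'n ^ 2 ^ 'k \<Rightarrow> real" where
  "moment \<alpha> \<beta> y = (\<Sum>l\<in>UNIV. y $ l $ 1 $ \<alpha> * y $ l $ 2 $ \<beta> - y $ l $ 1 $ \<beta> * y $ l $ 2 $ \<alpha>)"

text \<open>
  Since \<^const>\<open>moment\<close> is alternating in its two indices, all pairs of indices are admitted here, so
  that no order on \<open>'n\<close> is needed; see \<open>zero_level_less\<close> for the form with \<open>\<alpha> < \<beta>\<close>.
\<close>

definition zero_level :: "(real ^ 'n ^ 2 ^ 'k) set" where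
  "zero_level = {y. \<forall>\<alpha> \<beta>. moment \<alpha> \<beta> y = 0}"

lemma moment_same: "moment \<alpha> \<alpha> y = 0"
  by (simp add: moment_def)

lemma moment_swap: "moment \<beta> \<alpha> y = - moment \<alpha> \<beta> y"
  by (simp add: moment_def flip: sum_negf)

lemma zero_level_less:
  "(zero_level :: (real ^ ('n :: {finite, linorder}) ^ 2 ^ 'k) set)
    = {y. \<forall>\<alpha> \<beta>. \<alpha> < \<beta> \<longrightarrow> moment \<alpha> \<beta> y = 0}"
proof -
  have "moment \<alpha> \<beta> y = 0" if "\<forall>\<alpha> \<beta>. \<alpha> < \<beta> \<longrightarrow> moment \<alpha> \<beta> y = 0"
    for \<alpha> \<beta> :: 'n and y :: "real ^ ('n :: {finite, linorder}) ^ 2 ^ 'k"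
    using that moment_same[of \<alpha> y] moment_swap[of \<alpha> \<beta> y] by (cases \<alpha> \<beta> rule: linorder_cases) auto
  then show ?thesis
    by (auto simp: zero_level_def)
qed

definition symplectic_quotient :: "(real ^ 'n ^ 'n) monoid \<Rightarrow> (real ^ 'n ^ 2 ^ 'k) set set" where
  "symplectic_quotient G = orbits G zero_level diag_act"

text \<open>
  As the base field is infinite, the polynomial ring on V is identified with the ring of
  polynomial functions on V.
\<close>

definition polynomial_algebra :: "(real, real ^ 'n ^ 2 ^ 'k \<Rightarrow> real) module" where
  "polynomial_algebra =
    \<lparr>carrier = {f. real_polynomial_function f},
     mult = (\<lambda>f g y. f y * g y), one = (\<lambda>y. 1),
     zero = (\<lambda>y. 0), add = (\<lambda>f g y. f y + g y),
     smult = (\<lambda>c f y. c * f y)\<rparr>"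

definition invariant_algebra ::
    "(real ^ 'n ^ 'n) monoid \<Rightarrow> (real, real ^ 'n ^ 2 ^ 'k \<Rightarrow> real) module" where
  "invariant_algebra G = polynomial_algebra
    \<lparr>carrier := {f \<in> carrier polynomial_algebra. \<forall>A\<in>carrier G. \<forall>y. f (diag_act A y) = f y}\<rparr>"

definition vanishing_ideal :: "(real ^ 'n ^ 2 ^ 'k) set \<Rightarrow> (real ^ 'n ^ 2 ^ 'k \<Rightarrow> real) set" where
  "vanishing_ideal S = {f \<in> carrier polynomial_algebra. \<forall>y\<in>S. f y = 0}"

definition invariant_ideal :: "(real ^ 'n ^ 'n) monoid \<Rightarrow> (real ^ 'n ^ 2 ^ 'k \<Rightarrow> real) set" where
  "invariant_ideal G = vanishing_ideal zero_level \<inter> carrier (invariant_algebra G)"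

text \<open>
  \<^const>\<open>FactRing\<close> forgets the scalar multiplication; here it is put back, with the union in the
  same role as in \<^const>\<open>rcoset_mult\<close>.
\<close>

definition quotient_algebra :: "('r, 'a, 'm) module_scheme \<Rightarrow> 'a set \<Rightarrow> ('r, 'a set) module" where
  "quotient_algebra A I = ring.extend (A Quot I)
    (module.fields (\<lambda>c X. \<Union>a\<in>X. I +>\<^bsub>A\<^esub> (c \<odot>\<^bsub>A\<^esub> a)))"

definition regular_functions ::
    "(real ^ 'n ^ 'n) monoid \<Rightarrow> (real, (real ^ 'n ^ 2 ^ 'k \<Rightarrow> real) set) module" where
  "regular_functions G = quotient_algebra (invariant_algebra G) (invariant_ideal G)"

definition algebra_iso ::
    "('r, 'a, 'm) module_scheme \<Rightarrow> ('r, 'b, 'l) module_scheme \<Rightarrow> ('a \<Rightarrow> 'b) set" where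
  "algebra_iso A B =
    {h \<in> ring_iso A B. \<forall>c. \<forall>a\<in>carrier A. h (c \<odot>\<^bsub>A\<^esub> a) = c \<odot>\<^bsub>B\<^esub> h a}"

lemma group_O_group: "group (O_group :: (real ^ 'n ^ 'n) monoid)"
proof (rule groupI)
  fix A :: "real ^ 'n ^ 'n" assume "A \<in> carrier O_group"
  then show "\<exists>B\<in>carrier O_group. B \<otimes>\<^bsub>O_group\<^esub> A = \<one>\<^bsub>O_group\<^esub>"
    by (intro bexI[of _ "transpose A"]) (auto simp: O_group_def orthogonal_matrix_def)
qed (auto simp: O_group_def orthogonal_matrix_mul orthogonal_matrix_id matrix_mul_assoc)

lemma group_SO_group: "group (SO_group :: (real ^ 'n ^ 'n) monoid)"
proof (rule groupI)
  fix A :: "real ^ 'n ^ 'n" assume "A \<in> carrier SO_group"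
  then show "\<exists>B\<in>carrier SO_group. B \<otimes>\<^bsub>SO_group\<^esub> A = \<one>\<^bsub>SO_group\<^esub>"
    by (intro bexI[of _ "transpose A"])
      (auto simp: SO_group_def orthogonal_matrix_def)
qed (auto simp: SO_group_def orthogonal_matrix_mul orthogonal_matrix_id matrix_mul_assoc det_mul)

lemma cring_invariant_algebra: "cring (invariant_algebra G)"
proof (rule cringI)
  show "abelian_group (invariant_algebra G)"
  proof (rule abelian_groupI)
    fix f assume "f \<in> carrier (invariant_algebra G)"
    then show "\<exists>g\<in>carrier (invariant_algebra G).
        g \<oplus>\<^bsub>invariant_algebra G\<^esub> f = \<zero>\<^bsub>invariant_algebra G\<^esub>"
      by (intro bexI[of _ "\<lambda>y. - f y"])
        (auto simp: invariant_algebra_def polynomial_algebra_def real_polynomial_function_minus)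
  qed (auto simp: invariant_algebra_def polynomial_algebra_def)
  show "comm_monoid (invariant_algebra G)"
    by unfold_locales (auto simp: invariant_algebra_def polynomial_algebra_def)
qed (auto simp: invariant_algebra_def polynomial_algebra_def algebra_simps)

lemma ideal_invariant_ideal: "ideal (invariant_ideal G) (invariant_algebra G)"
proof (rule idealI)
  interpret cring "invariant_algebra G"
    by (rule cring_invariant_algebra)
  show "ring (invariant_algebra G)"
    by (rule ring_axioms)
  show "subgroup (invariant_ideal G) (add_monoid (invariant_algebra G))"
  proof (rule add.subgroupI)
    fix f assume f: "f \<in> invariant_ideal G"
    then have "(\<lambda>y. - f y) \<in> invariant_ideal G"
      by (auto simp: invariant_ideal_def vanishing_ideal_def invariant_algebra_def
          polynomial_algebra_def real_polynomial_function_minus)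
    moreover have "\<ominus>\<^bsub>invariant_algebra G\<^esub> f = (\<lambda>y. - f y)"
      using f calculation
      by (intro minus_equality)
        (auto simp: invariant_ideal_def invariant_algebra_def polynomial_algebra_def)
    ultimately show "\<ominus>\<^bsub>invariant_algebra G\<^esub> f \<in> invariant_ideal G"
      by simp
  next
    have "(\<lambda>y. 0) \<in> invariant_ideal G"
      by (auto simp: invariant_ideal_def vanishing_ideal_def invariant_algebra_def
          polynomial_algebra_def)
    then show "invariant_ideal G \<noteq> {}"
      by blast
  qed (auto simp: invariant_ideal_def vanishing_ideal_def invariant_algebra_def
      polynomial_algebra_def)
qed (auto simp: invariant_ideal_def vanishing_ideal_def invariant_algebra_def
    polynomial_algebra_def)

end

theory Submission
  imports Defs
begin

text \<open>
  For \<open>y\<close> in the zero level, the moment equations say that the row space of the \<open>n \<times> 2k\<close> matrix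
  formed by the vectors of \<open>y\<close> is isotropic for the standard symplectic form, hence of dimension
  at most \<open>k < n\<close>.  So some nonzero vector is orthogonal to all vectors of \<open>y\<close>, and the reflection
  along it has determinant \<open>-1\<close> and fixes \<open>y\<close>; this makes the two orbits of \<open>y\<close> equal.
  Averaging an \<open>SO\<close>-invariant polynomial with its translate by a reflection gives an
  \<open>O\<close>-invariant one with the same values on the zero level, so every class of \<open>SO\<close>-invariants
  modulo the ideal contains an \<open>O\<close>-invariant.
\<close>

section \<open>Reflections and isotropic subspaces\<close>

text \<open>A coordinate reflection \<open>D\<close>, conjugated by an orthogonal matrix carrying
  the flipped axis to the direction of \<open>v\<close>, is the reflection along
  \<open>v\<close>.\<close>

lemma reflection_matrix_exists:
  fixes v :: "real ^ 'n"
  assumes "v \<noteq> 0"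
  obtains A :: "real ^ 'n ^ 'n"
    where "orthogonal_matrix A" "det A = -1" "\<And>x. v \<bullet> x = 0 \<Longrightarrow> A *v x = x"
proof -
  fix a :: 'n
  define D :: "real ^ 'n ^ 'n" where "D = (\<chi> i j. if i = j then if i = a then -1 else 1 else 0)"
  obtain B :: "real ^ 'n ^ 'n"
    where B: "orthogonal_matrix B" "B *v axis a 1 = v /\<^sub>R norm v"
    using orthogonal_matrix_exists_basis[of "v /\<^sub>R norm v" a] assms by auto
  have D_mult: "(D *v x) $ i = (if i = a then - (x $ i) else x $ i)" for x i
    by (simp add: D_def matrix_vector_mult_def if_distrib[of "\<lambda>t. t * _"] cong: if_cong)
  have "D *v (D *v x) = x" for x
    by (simp add: vec_eq_iff D_mult)
  then have "D ** D = mat 1"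
    by (simp add: matrix_eq flip: matrix_vector_mul_assoc)
  moreover have "transpose D = D"
    by (auto simp: transpose_def D_def vec_eq_iff)
  ultimately have D: "orthogonal_matrix D"
    by (simp add: orthogonal_matrix_def)
  have det_D: "det D = -1"
    by (subst det_diagonal) (auto simp: D_def prod.delta)
  have det_B: "det B * det B = 1"
    using det_orthogonal_matrix[OF B(1)] by auto
  have BB: "B ** transpose B = mat 1"
    using B(1) by (simp add: orthogonal_matrix_def)
  define A where "A = B ** D ** transpose B"
  show thesis
  proof
    show "orthogonal_matrix A"
      unfolding A_def using B D by (simp add: orthogonal_matrix_mul orthogonal_matrix_transpose)
    show "det A = -1"
      using det_B by (simp add: A_def det_mul det_D)
    fix x assume x: "v \<bullet> x = 0"
    \<comment> \<open>Only coordinate \<open>a\<close> is flipped by \<open>D\<close>; for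
      \<open>transpose B *v x\<close> this coordinate is a multiple of \<open>v \<bullet> x\<close>,
      hence zero.\<close>
    have "(transpose B *v x) $ a = (B *v axis a 1) \<bullet> x"
      by (metis cart_eq_inner_axis dot_lmul_matrix inner_commute transpose_matrix_vector)
    also have "\<dots> = 0"
      using x by (simp add: B(2))
    finally have "D *v (transpose B *v x) = transpose B *v x"
      by (simp add: vec_eq_iff D_mult)
    then show "A *v x = x"
      by (simp add: A_def BB matrix_vector_mul_assoc[symmetric] del: transpose_matrix_vector)
        (simp add: matrix_vector_mul_assoc BB del: transpose_matrix_vector)
  qed
qed

text \<open>The complex structure \<open>J\<close> turns symplectic orthogonality into Euclidean
  orthogonality. Thus \<open>S\<close> and its image under \<open>J\<close> are orthogonal and of
  equal dimension inside a space of dimension twice \<open>CARD('k)\<close>.\<close>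

lemma dim_isotropic_le:
  fixes S :: "(real ^ 2 ^ 'k) set"
  assumes "\<And>x y. x \<in> S \<Longrightarrow> y \<in> S \<Longrightarrow> (\<Sum>l\<in>UNIV. x $ l $ 1 * y $ l $ 2 - x $ l $ 2 * y $ l $ 1) = 0"
  shows "dim S \<le> CARD('k)"
proof -
  define J :: "real ^ 2 ^ 'k \<Rightarrow> real ^ 2 ^ 'k"
    where "J x = (\<chi> l. vector [- x $ l $ 2, x $ l $ 1])" for x
  have "linear J"
    by (rule linearI) (auto simp: J_def vec_eq_iff forall_2)
  moreover have "inj J"
    by (rule injI) (auto simp: J_def vec_eq_iff forall_2)
  ultimately have "dim (J ` S) = dim S"
    by (rule dim_image_eq[OF _ inj_on_subset]) auto
  moreover have "dim (S \<union> J ` S) = dim S + dim (J ` S)"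
  proof (rule dim_orthogonal_sum)
    fix x y assume "x \<in> S" "y \<in> J ` S"
    then obtain z where z: "z \<in> S" "y = J z"
      by blast
    show "x \<bullet> y = 0"
      using assms[OF z(1) \<open>x \<in> S\<close>] by (simp add: z(2) J_def inner_vec_def sum_2 algebra_simps)
  qed
  moreover have "dim (S \<union> J ` S) \<le> CARD('k) * 2"
    using dim_subset_UNIV[of "S \<union> J ` S"] by simp
  ultimately show ?thesis
    by linarith
qed

lemma zero_level_orthogonal_vector:
  fixes y :: "real ^ 'n ^ 2 ^ 'k"
  assumes card: "CARD('n) > CARD('k)" and y: "y \<in> zero_level"
  obtains v where "v \<noteq> 0" "\<And>l i. v \<bullet> y $ l $ i = 0"
proof -
  \<comment> \<open>The range of \<open>T\<close> is the row space of the matrix formed by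
    \<open>y\<close>, and its kernel consists of the vectors sought.\<close>
  define T :: "real ^ 'n \<Rightarrow> real ^ 2 ^ 'k" where "T v = (\<chi> l i. v \<bullet> y $ l $ i)" for v
  have T: "linear T"
    by (rule linearI) (auto simp: T_def vec_eq_iff inner_left_distrib)
  have "dim (range T) \<le> CARD('k)"
  proof (rule dim_isotropic_le)
    fix a b assume "a \<in> range T" "b \<in> range T"
    then obtain u v where uv: "a = T u" "b = T v"
      by blast
    \<comment> \<open>The symplectic form of \<open>T u\<close> and \<open>T v\<close> is the
      bilinear form with matrix \<open>moment \<alpha> \<beta> y\<close> at \<open>u\<close> and
      \<open>v\<close>; the two swaps move the sum over \<open>l\<close> innermost to expose
      it.\<close>
    have "(\<Sum>l\<in>UNIV. a $ l $ 1 * b $ l $ 2 - a $ l $ 2 * b $ l $ 1)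
        = (\<Sum>l\<in>UNIV. \<Sum>\<alpha>\<in>UNIV. \<Sum>\<beta>\<in>UNIV. u $ \<alpha> * v $ \<beta> *
            (y $ l $ 1 $ \<alpha> * y $ l $ 2 $ \<beta> - y $ l $ 1 $ \<beta> * y $ l $ 2 $ \<alpha>))"
      by (simp add: uv T_def inner_vec_def sum_product flip: sum_subtractf) (simp add: algebra_simps)
    also have "\<dots> = (\<Sum>\<alpha>\<in>UNIV. \<Sum>l\<in>UNIV. \<Sum>\<beta>\<in>UNIV. u $ \<alpha> * v $ \<beta> *
            (y $ l $ 1 $ \<alpha> * y $ l $ 2 $ \<beta> - y $ l $ 1 $ \<beta> * y $ l $ 2 $ \<alpha>))"
      by (rule sum.swap)
    also have "\<dots> = (\<Sum>\<alpha>\<in>UNIV. \<Sum>\<beta>\<in>UNIV. \<Sum>l\<in>UNIV. u $ \<alpha> * v $ \<beta> *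
            (y $ l $ 1 $ \<alpha> * y $ l $ 2 $ \<beta> - y $ l $ 1 $ \<beta> * y $ l $ 2 $ \<alpha>))"
      by (intro sum.cong refl sum.swap)
    also have "\<dots> = (\<Sum>\<alpha>\<in>UNIV. \<Sum>\<beta>\<in>UNIV. u $ \<alpha> * v $ \<beta> * moment \<alpha> \<beta> y)"
      by (simp add: moment_def sum_distrib_left)
    also have "\<dots> = 0"
      using y by (simp add: zero_level_def)
    finally show "(\<Sum>l\<in>UNIV. a $ l $ 1 * b $ l $ 2 - a $ l $ 2 * b $ l $ 1) = 0" .
  qed
  \<comment> \<open>An injective \<open>T\<close> would have a range of dimension
    \<open>CARD('n)\<close>.\<close>
  then have "\<not> inj T"
    using dim_image_eq[OF T, of UNIV] card by auto
  then obtain v where "v \<noteq> 0" "T v = 0"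
    using T by (auto simp: linear_injective_0)
  then show thesis
    by (intro that[of v]) (auto simp: T_def vec_eq_iff)
qed

section \<open>Orbits and invariants of the two groups\<close>

lemma diag_act_mult: "diag_act (A ** B) y = diag_act A (diag_act B y)"
  by (simp add: diag_act_def vec_eq_iff matrix_vector_mul_assoc)

lemma bounded_linear_diag_act: "bounded_linear (diag_act A)"
  by (intro linear_conv_bounded_linear[THEN iffD1] linearI)
    (auto simp: diag_act_def vec_eq_iff matrix_vector_right_distrib matrix_vector_mult_scaleR)

text \<open>A reflection \<open>R\<close> fixes \<open>y\<close>, so an orthogonal \<open>A\<close>
  of determinant \<open>-1\<close> can be replaced by \<open>A ** R\<close>, which has determinant
  \<open>1\<close> and moves \<open>y\<close> to the same point.\<close>

lemma orbit_O_eq_SO: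
  fixes y :: "real ^ 'n ^ 2 ^ 'k"
  assumes "CARD('n) > CARD('k)" "y \<in> zero_level"
  shows "orbit O_group diag_act y = orbit SO_group diag_act y"
proof
  obtain v :: "real ^ 'n" where v: "v \<noteq> 0" "\<And>l i. v \<bullet> y $ l $ i = 0"
    using zero_level_orthogonal_vector[OF assms] by metis
  obtain R :: "real ^ 'n ^ 'n"
    where R: "orthogonal_matrix R" "det R = -1" "\<And>x. v \<bullet> x = 0 \<Longrightarrow> R *v x = x"
    using reflection_matrix_exists[OF v(1)] by metis
  have Ry: "diag_act R y = y"
    using R(3) v(2) by (simp add: diag_act_def vec_eq_iff)
  show "orbit O_group diag_act y \<subseteq> orbit SO_group diag_act y"
  proof
    fix z assume "z \<in> orbit O_group diag_act y"
    then obtain A where A: "orthogonal_matrix A" "z = diag_act A y"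
      by (auto simp: orbit_def O_group_def)
    show "z \<in> orbit SO_group diag_act y"
    proof (cases "det A = 1")
      case True
      then show ?thesis
        using A by (auto simp: orbit_def SO_group_def)
    next
      case False
      then have "det (A ** R) = 1"
        using det_orthogonal_matrix[OF A(1)] by (simp add: det_mul R(2))
      then have "A ** R \<in> carrier SO_group"
        using A R by (simp add: SO_group_def orthogonal_matrix_mul)
      moreover have "z = diag_act (A ** R) y"
        by (simp add: A(2) diag_act_mult Ry)
      ultimately show ?thesis
        by (auto simp: orbit_def)
    qed
  qed
qed (auto simp: orbit_def O_group_def SO_group_def)

lemma SO_invariant_equals_O_invariant_on_zero_level:
  fixes f :: "real ^ 'n ^ 2 ^ 'k \<Rightarrow> real"
  assumes card: "CARD('n) > CARD('k)" and f: "f \<in> carrier (invariant_algebra SO_group)"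
  obtains g where "g \<in> carrier (invariant_algebra O_group)" "\<And>y. y \<in> zero_level \<Longrightarrow> g y = f y"
proof -
  \<comment> \<open>A single reflection serves for all \<open>y\<close>, which keeps the average
    \<open>g\<close> polynomial. The reflections fixing points of the zero level vary with the point
    and enter only through \<open>orbit_O_eq_SO\<close>.\<close>
  obtain R :: "real ^ 'n ^ 'n" where R: "orthogonal_matrix R" "det R = -1"
    using reflection_matrix_exists[of "axis undefined 1"] by (metis axis_eq_0_iff zero_neq_one)
  have f_poly: "real_polynomial_function f"
    and f_inv: "orthogonal_matrix A \<Longrightarrow> det A = 1 \<Longrightarrow> f (diag_act A y) = f y" for A y
    using f by (auto simp: invariant_algebra_def polynomial_algebra_def SO_group_def)
  \<comment> \<open>The quotient \<open>A ** transpose B\<close> has determinant \<open>1\<close>,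
    so \<open>f\<close> sees only the coset of the special orthogonal group.\<close>
  have coset: "f (diag_act A y) = f (diag_act B y)"
    if "orthogonal_matrix A" "orthogonal_matrix B" "det A = det B" for A B y
  proof -
    have "orthogonal_matrix (A ** transpose B)" "det (A ** transpose B) = 1"
      using that det_orthogonal_matrix[OF that(2)]
      by (auto simp: orthogonal_matrix_mul orthogonal_matrix_transpose det_mul)
    then have "f (diag_act (A ** transpose B) (diag_act B y)) = f (diag_act B y)"
      by (rule f_inv)
    moreover have "A ** transpose B ** B = A"
      using that(2) by (simp add: orthogonal_matrix_def flip: matrix_mul_assoc)
    ultimately show ?thesis
      by (simp flip: diag_act_mult)
  qed
  define g where "g y = (f y + f (diag_act R y)) * (1 / 2)" for y
  show thesis
  proof
    have "polynomial_function (diag_act R :: real ^ 'n ^ 2 ^ 'k \<Rightarrow> _)"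
      by (simp add: polynomial_function_bounded_linear bounded_linear_diag_act)
    then have "real_polynomial_function (f \<circ> diag_act R)"
      using f_poly by (rule real_polynomial_function_compose)
    then have "real_polynomial_function g"
      unfolding g_def[abs_def] using f_poly by (auto simp: o_def)
    moreover have "g (diag_act A y) = g y" if A: "orthogonal_matrix A" for A y
    proof -
      have RA: "orthogonal_matrix (R ** A)" "det (R ** A) = - det A"
        using A R by (auto simp: orthogonal_matrix_mul det_mul)
      \<comment> \<open>Determinant \<open>1\<close> preserves both terms of the average;
        determinant \<open>-1\<close> exchanges them.\<close>
      consider "det A = 1" | "det A = -1"
        using det_orthogonal_matrix[OF A] by blast
      then show ?thesis
      proof cases
        case 1
        then show ?thesis
          using f_inv[OF A 1] coset[OF RA(1) R(1)] RA R by (simp add: g_def diag_act_mult)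
      next
        case 2
        then show ?thesis
          using coset[OF A R(1)] f_inv[OF RA(1)] RA R by (simp add: g_def diag_act_mult)
      qed
    qed
    ultimately show "g \<in> carrier (invariant_algebra O_group)"
      by (auto simp: invariant_algebra_def polynomial_algebra_def O_group_def)
    fix y :: "real ^ 'n ^ 2 ^ 'k" assume "y \<in> zero_level"
    \<comment> \<open>Equality of orbits makes \<open>diag_act R y\<close> a special orthogonal
      translate of \<open>y\<close>, so the two averaged values agree.\<close>
    have "diag_act R y \<in> orbit O_group diag_act y"
      using R by (auto simp: orbit_def O_group_def)
    then obtain A where "orthogonal_matrix A" "det A = 1" "diag_act R y = diag_act A y"
      using orbit_O_eq_SO[OF card \<open>y \<in> zero_level\<close>] by (auto simp: orbit_def SO_group_def)
    then show "g y = f y"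
      by (simp add: g_def f_inv)
  qed
qed

section \<open>Quotients of algebras by ideals\<close>

text \<open>The union defining scalar multiplication collapses: scaling keeps \<open>I\<close>
  inside itself, so all representatives give one coset, and \<open>x\<close> itself shows that the
  union is not empty.\<close>

lemma quotient_algebra_smult_coset:
  fixes A :: "('r, 'a, 'm) module_scheme" (structure)
  assumes I: "ideal I A" and x: "x \<in> carrier A"
    and closed: "\<And>a. a \<in> carrier A \<Longrightarrow> c \<odot> a \<in> carrier A"
    and distr: "\<And>a b. a \<in> carrier A \<Longrightarrow> b \<in> carrier A \<Longrightarrow> c \<odot> (a \<oplus> b) = c \<odot> a \<oplus> c \<odot> b"
    and I_closed: "\<And>a. a \<in> I \<Longrightarrow> c \<odot> a \<in> I"
  shows "c \<odot>\<^bsub>quotient_algebra A I\<^esub> (I +> x) = I +> (c \<odot> x)"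
proof -
  interpret ideal I A by fact
  have "I +> (c \<odot> a) = I +> (c \<odot> x)" if a: "a \<in> I +> x" for a
  proof -
    obtain i where i: "i \<in> I" "a = i \<oplus> x"
      using a by (auto simp: a_r_coset_def')
    then have "c \<odot> a = c \<odot> i \<oplus> c \<odot> x"
      using x by (simp add: distr a_Hcarr)
    then have "c \<odot> a \<in> I +> (c \<odot> x)"
      using I_closed[OF i(1)] by (auto simp: a_r_coset_def')
    then show ?thesis
      using a_repr_independence[OF _ closed[OF x] a_subgroup] by metis
  qed
  moreover have "x \<in> I +> x"
    using x by (rule a_rcos_self)
  ultimately have "(\<Union>a\<in>I +> x. I +> (c \<odot> a)) = I +> (c \<odot> x)"
    by blast
  then show ?thesis
    by (simp add: quotient_algebra_def ring.defs module.defs)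
qed

text \<open>The projection modulo \<open>J\<close>, restricted to \<open>S\<close>, has kernel
  \<open>J \<inter> S\<close> and is onto because \<open>S\<close> meets every coset. The first
  isomorphism theorem gives a ring isomorphism, and representatives show that it respects
  scalars.\<close>

lemma quotient_algebra_iso_subalgebra:
  fixes B :: "('r, 'a, 'm) module_scheme" and S :: "'a set"
  defines "A \<equiv> B\<lparr>carrier := S\<rparr>"
  assumes A: "ring A" and J: "ideal J B" and S: "S \<subseteq> carrier B"
    and rep: "\<And>b. b \<in> carrier B \<Longrightarrow> \<exists>a\<in>S. J +>\<^bsub>B\<^esub> a = J +>\<^bsub>B\<^esub> b"
    and closed: "\<And>c a. a \<in> carrier B \<Longrightarrow> c \<odot>\<^bsub>B\<^esub> a \<in> carrier B"
    and S_closed: "\<And>c a. a \<in> S \<Longrightarrow> c \<odot>\<^bsub>B\<^esub> a \<in> S"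
    and J_closed: "\<And>c a. a \<in> J \<Longrightarrow> c \<odot>\<^bsub>B\<^esub> a \<in> J"
    and distr: "\<And>c a b. a \<in> carrier B \<Longrightarrow> b \<in> carrier B \<Longrightarrow>
      c \<odot>\<^bsub>B\<^esub> (a \<oplus>\<^bsub>B\<^esub> b) = c \<odot>\<^bsub>B\<^esub> a \<oplus>\<^bsub>B\<^esub> c \<odot>\<^bsub>B\<^esub> b"
  shows "\<exists>h\<in>algebra_iso (quotient_algebra A (J \<inter> S)) (quotient_algebra B J).
    \<forall>a\<in>S. h ((J \<inter> S) +>\<^bsub>A\<^esub> a) = J +>\<^bsub>B\<^esub> a"
proof -
  let ?p = "\<lambda>a. J +>\<^bsub>B\<^esub> a"
  have carrier_A: "carrier A = S" and smult_A: "smult A = smult B"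
    and zero_quot: "\<zero>\<^bsub>B Quot J\<^esub> = J"
    by (simp_all add: A_def FactRing_def)
  have carrier_quot: "carrier (B Quot J) = ?p ` carrier B"
    by (auto simp: FactRing_def A_RCOSETS_def')
  have carrier_quotient_algebra: "carrier (quotient_algebra A I) = (\<lambda>a. I +>\<^bsub>A\<^esub> a) ` S" for I
    by (auto simp: quotient_algebra_def ring.defs FactRing_def A_RCOSETS_def' carrier_A)
  have q: "ring_hom_ring B (B Quot J) ?p"
    using J by (rule ideal.rcos_ring_hom_ring)
  have p: "ring_hom_ring A (B Quot J) ?p"
  proof (rule ring_hom_ringI[OF A ideal.quotient_is_ring[OF J]])
    fix a b assume "a \<in> carrier A" "b \<in> carrier A"
    then have ab: "a \<in> carrier B" "b \<in> carrier B"
      using S by (auto simp: A_def)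
    show "?p a \<in> carrier (B Quot J)"
      using ab(1) by (simp add: carrier_quot)
    show "?p (a \<otimes>\<^bsub>A\<^esub> b) = ?p a \<otimes>\<^bsub>B Quot J\<^esub> ?p b"
      using ring_hom_mult[OF ring_hom_ring.homh[OF q] ab] by (simp add: A_def)
    show "?p (a \<oplus>\<^bsub>A\<^esub> b) = ?p a \<oplus>\<^bsub>B Quot J\<^esub> ?p b"
      using ring_hom_add[OF ring_hom_ring.homh[OF q] ab] by (simp add: A_def)
  next
    show "?p \<one>\<^bsub>A\<^esub> = \<one>\<^bsub>B Quot J\<^esub>"
      using ring_hom_one[OF ring_hom_ring.homh[OF q]] by (simp add: A_def)
  qed
  have "?p a = J \<longleftrightarrow> a \<in> J" if "a \<in> S" for a
  proof -
    interpret ideal J B by (rule J)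
    have "a \<in> carrier B"
      using that S by (rule subsetD[rotated])
    then show ?thesis
      using a_coset_join1[OF _ _ a_subgroup] a_coset_join2[OF _ a_subgroup] by metis
  qed
  then have ker: "a_kernel A (B Quot J) ?p = J \<inter> S"
    unfolding a_kernel_def' carrier_A zero_quot by blast
  have surj: "?p ` carrier A = carrier (B Quot J)"
    unfolding carrier_A carrier_quot using rep S by blast
  \<comment> \<open>The projection is constant on each coset of its kernel, so the image is a
    singleton; this is the map used by \<open>FactRing_iso_set\<close>.\<close>
  define h where "h X = the_elem (?p ` X)" for X
  have iso: "h \<in> ring_iso (A Quot (J \<inter> S)) (B Quot J)"
    unfolding h_def[abs_def] using ring_hom_ring.FactRing_iso_set[OF p surj] unfolding ker .
  have h: "h ((J \<inter> S) +>\<^bsub>A\<^esub> a) = ?p a" if "a \<in> S" for a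
    using ring_hom_ring.the_elem_simp[OF p, of a] that unfolding h_def ker carrier_A by blast
  have idA: "ideal (J \<inter> S) A"
    using ring_hom_ring.kernel_is_ideal[OF p] unfolding ker .
  have "h \<in> algebra_iso (quotient_algebra A (J \<inter> S)) (quotient_algebra B J)"
    unfolding algebra_iso_def
  proof (intro CollectI conjI allI ballI)
    show "h \<in> ring_iso (quotient_algebra A (J \<inter> S)) (quotient_algebra B J)"
      using iso by (simp add: ring_iso_def ring_hom_def quotient_algebra_def ring.defs)
    fix c X assume "X \<in> carrier (quotient_algebra A (J \<inter> S))"
    then obtain a where a: "a \<in> S" and X: "X = (J \<inter> S) +>\<^bsub>A\<^esub> a"
      unfolding carrier_quotient_algebra by blast
    have "c \<odot>\<^bsub>quotient_algebra A (J \<inter> S)\<^esub> X = (J \<inter> S) +>\<^bsub>A\<^esub> (c \<odot>\<^bsub>A\<^esub> a)"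
      unfolding X
    proof (rule quotient_algebra_smult_coset[OF idA])
      show "c \<odot>\<^bsub>A\<^esub> (x \<oplus>\<^bsub>A\<^esub> y) = c \<odot>\<^bsub>A\<^esub> x \<oplus>\<^bsub>A\<^esub> c \<odot>\<^bsub>A\<^esub> y"
        if "x \<in> carrier A" "y \<in> carrier A" for x y
        using that S distr[of x y c] by (auto simp: A_def)
    qed (use a S_closed J_closed in \<open>auto simp: carrier_A smult_A\<close>)
    moreover have "c \<odot>\<^bsub>quotient_algebra B J\<^esub> ?p a = ?p (c \<odot>\<^bsub>B\<^esub> a)"
      using a S by (intro quotient_algebra_smult_coset J closed distr J_closed) auto
    ultimately show "h (c \<odot>\<^bsub>quotient_algebra A (J \<inter> S)\<^esub> X) = c \<odot>\<^bsub>quotient_algebra B J\<^esub> h X"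
      using h[OF a] h[OF S_closed[OF a]] by (simp add: X smult_A)
  qed
  with h show ?thesis
    by blast
qed

section \<open>Comparison of the two symplectic quotients\<close>

theorem theorem4p1:
  assumes "CARD('n) \<ge> CARD('k) + 1"
  shows "(\<forall>y \<in> (zero_level :: (real ^ 'n ^ 2 ^ 'k) set). orbit O_group diag_act y = orbit SO_group diag_act y)
    \<and> (symplectic_quotient O_group :: (real ^ 'n ^ 2 ^ 'k) set set) = symplectic_quotient SO_group
    \<and> carrier (invariant_algebra O_group :: (real, real ^ 'n ^ 2 ^ 'k \<Rightarrow> real) module)
        \<subseteq> carrier (invariant_algebra SO_group)
    \<and> (\<exists>h \<in> algebra_iso (regular_functions O_group :: (real, (real ^ 'n ^ 2 ^ 'k \<Rightarrow> real) set) module)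
              (regular_functions SO_group).
        \<forall>f \<in> carrier (invariant_algebra O_group).
          h (invariant_ideal O_group +>\<^bsub>invariant_algebra O_group\<^esub> f)
          = invariant_ideal SO_group +>\<^bsub>invariant_algebra SO_group\<^esub> f)"
proof (intro conjI)
  let ?A = "invariant_algebra O_group :: (real, real ^ 'n ^ 2 ^ 'k \<Rightarrow> real) module"
  let ?B = "invariant_algebra SO_group :: (real, real ^ 'n ^ 2 ^ 'k \<Rightarrow> real) module"
  let ?J = "invariant_ideal SO_group :: (real ^ 'n ^ 2 ^ 'k \<Rightarrow> real) set"
  have card: "CARD('n) > CARD('k)"
    using assms by simp
  show orbits: "\<forall>y \<in> (zero_level :: (real ^ 'n ^ 2 ^ 'k) set).
      orbit O_group diag_act y = orbit SO_group diag_act y"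
    using orbit_O_eq_SO[OF card] by blast
  then show "(symplectic_quotient O_group :: (real ^ 'n ^ 2 ^ 'k) set set) = symplectic_quotient SO_group"
    by (force simp: symplectic_quotient_def orbits_def)
  show sub: "carrier ?A \<subseteq> carrier ?B"
    by (auto simp: invariant_algebra_def O_group_def SO_group_def)
  \<comment> \<open>The two invariant algebras differ only in their carriers, and the ideals only by
    intersection, as \<open>quotient_algebra_iso_subalgebra\<close> requires.\<close>
  have A: "?A = ?B\<lparr>carrier := carrier ?A\<rparr>"
    by (simp add: invariant_algebra_def)
  have I: "invariant_ideal O_group = ?J \<inter> carrier ?A"
    using sub by (auto simp: invariant_ideal_def)
  interpret J: ideal ?J ?B
    by (rule ideal_invariant_ideal)
  have "\<exists>h\<in>algebra_iso (quotient_algebra (?B\<lparr>carrier := carrier ?A\<rparr>) (?J \<inter> carrier ?A))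
        (quotient_algebra ?B ?J).
      \<forall>a\<in>carrier ?A. h ((?J \<inter> carrier ?A) +>\<^bsub>?B\<lparr>carrier := carrier ?A\<rparr>\<^esub> a) = ?J +>\<^bsub>?B\<^esub> a"
  proof (rule quotient_algebra_iso_subalgebra)
    show "ring (?B\<lparr>carrier := carrier ?A\<rparr>)"
      unfolding A[symmetric] by (rule cring.axioms(1)[OF cring_invariant_algebra])
    show "ideal ?J ?B"
      by (rule ideal_invariant_ideal)
    show "\<exists>g\<in>carrier ?A. ?J +>\<^bsub>?B\<^esub> g = ?J +>\<^bsub>?B\<^esub> f" if f: "f \<in> carrier ?B" for f
    proof -
      obtain g where g: "g \<in> carrier ?A" "\<And>y. y \<in> zero_level \<Longrightarrow> g y = f y"
        using SO_invariant_equals_O_invariant_on_zero_level[OF card f] by metis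
      \<comment> \<open>The average \<open>g\<close> represents the coset of \<open>f\<close>, since
        their difference vanishes on the zero level.\<close>
      have "(\<lambda>y. g y - f y) \<in> ?J"
        using f g sub by (auto simp: invariant_ideal_def vanishing_ideal_def invariant_algebra_def
            polynomial_algebra_def)
      then have "g \<in> ?J +>\<^bsub>?B\<^esub> f"
        by (force simp: a_r_coset_def' invariant_algebra_def polynomial_algebra_def)
      then show ?thesis
        using J.a_repr_independence[OF _ f J.a_subgroup] g(1) by metis
    qed
  qed (use sub in \<open>auto simp: invariant_ideal_def vanishing_ideal_def invariant_algebra_def
      polynomial_algebra_def algebra_simps\<close>)
  then show "\<exists>h \<in> algebra_iso (regular_functions O_group :: (real, (real ^ 'n ^ 2 ^ 'k \<Rightarrow> real) set) module)
          (regular_functions SO_group).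
      \<forall>f \<in> carrier ?A. h (invariant_ideal O_group +>\<^bsub>?A\<^esub> f) = ?J +>\<^bsub>?B\<^esub> f"
    unfolding regular_functions_def I A[symmetric] .
qed

end
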